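(* For every fixed integer $w\ge 1$ there exists a constant $c>0$ depending only on $w$ such that for all integers $n,r$ with $2\le r<n$, $$t(n,w,r)\ \ge\ c\cdot\min\left\{n^w,\ \frac{r^{w+1}\log n}{\log r}\right\}.$$
   Context: A family (set) of sets $\mathcal{F}$ is $(w,r)$-cover-free if for all $A_1,\dots,A_w\in\mathcal{F}$ and all $B_1,\dots,B_r\in\mathcal{F}\setminus\{A_1,\dots,A_w\}$ (repetitions allowed among the $A_i$ and among the $B_i$) we have $\bigcap_{i=1}^w A_i\nsubseteq\bigcup_{i=1}^r B_i$. For given $n$, $t(n,w,r)$ denotes the minimal $t$ such that there exists a $(w,r)$-cover-free family $\mathcal{F}\subseteq\mathcal{P}(\{1,\dots,t\})$ with exactly $n$ (distinct) sets. *)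

theory Defs
  imports Complex_Main
begin

text \<open>
  The indexed families \<open>A\<close> and \<open>B\<close> need not be injective, so repetitions are allowed.
\<close>

definition cover_free :: "nat \<Rightarrow> nat \<Rightarrow> 'a set set \<Rightarrow> bool" where
  "cover_free w r F \<longleftrightarrow>
     (\<forall>A B :: nat \<Rightarrow> 'a set.
        (\<forall>i\<in>{1..w}. A i \<in> F) \<and> (\<forall>j\<in>{1..r}. B j \<in> F - A ` {1..w}) \<longrightarrow>
        \<not> (\<Inter>i\<in>{1..w}. A i) \<subseteq> (\<Union>j\<in>{1..r}. B j))"

definition cover_free_number :: "nat \<Rightarrow> nat \<Rightarrow> nat \<Rightarrow> nat" where
  "cover_free_number n w r =
     (LEAST t. \<exists>F. F \<subseteq> Pow {1..t} \<and> card F = n \<and> cover_free w r F)"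

text \<open>
  A family as required exists for all parameters, so the minimum in the definition of
  \<^const>\<open>cover_free_number\<close> is attained: use all subsets \<open>S\<close> of the index set as points,
  and let the \<open>i\<close>-th set consist of those \<open>S\<close> that contain \<open>i\<close>.
\<close>

lemma cover_free_family_exists:
  fixes n w r :: nat
  shows "\<exists>t F. F \<subseteq> Pow {1..t::nat} \<and> card F = n \<and> cover_free w r F"
proof -
  obtain h where h: "bij_betw h (Pow {..<n}) {1..card (Pow {..<n})}"
    using finite_same_card_bij[of "Pow {..<n}" "{1..card (Pow {..<n})}"]
    by (metis card_atLeastAtMost diff_Suc_1 finite_Pow_iff finite_atLeastAtMost finite_lessThan)
  define X where "X i = h ` {S \<in> Pow {..<n}. i \<in> S}" for i
  have X_iff: "h S \<in> X i \<longleftrightarrow> i \<in> S" if "S \<subseteq> {..<n}" for S i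
  proof
    assume "h S \<in> X i"
    then obtain T where T: "T \<subseteq> {..<n}" "i \<in> T" "h S = h T"
      unfolding X_def by blast
    with that have "S = T"
      using inj_onD[OF bij_betw_imp_inj_on[OF h], of S T] by simp
    with T show "i \<in> S" by simp
  qed (use that in \<open>simp add: X_def\<close>)
  have inj: "inj_on X {..<n}"
  proof (rule inj_onI)
    fix i j assume ij: "i \<in> {..<n}" "X i = X j"
    from ij(1) have i: "{i} \<subseteq> {..<n}" by simp
    have "h {i} \<in> X j" using X_iff[OF i, of i] ij(2) by simp
    then show "i = j" using X_iff[OF i, of j] by simp
  qed
  let ?F = "X ` {..<n}"
  have "?F \<subseteq> Pow {1..card (Pow {..<n})}"
  proof -
    have "X i \<subseteq> h ` Pow {..<n}" for i unfolding X_def by (rule image_mono) blast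
    then show ?thesis unfolding bij_betw_imp_surj_on[OF h] by (simp add: image_subset_iff)
  qed
  moreover have "card ?F = n"
    using inj by (simp add: card_image)
  moreover have "cover_free w r ?F"
    unfolding cover_free_def
  proof (intro allI impI notI, elim conjE)
    fix A B :: "nat \<Rightarrow> nat set"
    assume A: "\<forall>i\<in>{1..w}. A i \<in> ?F" and B: "\<forall>j\<in>{1..r}. B j \<in> ?F - A ` {1..w}"
      and sub: "(\<Inter>i\<in>{1..w}. A i) \<subseteq> (\<Union>j\<in>{1..r}. B j)"
    define S where "S = {a \<in> {..<n}. X a \<in> A ` {1..w}}"
    have S: "S \<subseteq> {..<n}" by (auto simp: S_def)
    have "h S \<in> (\<Inter>i\<in>{1..w}. A i)"
    proof
      fix i assume i: "i \<in> {1..w}"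
      with A obtain a where "a < n" "A i = X a" by blast
      with i have "X a \<in> A ` {1..w}" by (metis imageI)
      with \<open>a < n\<close> have "a \<in> S" by (simp add: S_def)
      then show "h S \<in> A i" using X_iff[OF S] \<open>A i = X a\<close> by simp
    qed
    with sub obtain j where j: "j \<in> {1..r}" "h S \<in> B j" by blast
    with B obtain b where "b < n" "B j = X b" by blast
    with j X_iff[OF S] have "b \<in> S" by simp
    then have "B j \<in> A ` {1..w}" using \<open>B j = X b\<close> by (simp add: S_def)
    moreover have "B j \<notin> A ` {1..w}" using B j(1) by blast
    ultimately show False by contradiction
  qed
  ultimately show ?thesis by blast
qed

end

theory Submission
  imports Defs
begin

text \<open>
  Let \<open>F\<close> be \<open>(w, r)\<close>-cover-free with \<open>n\<close> members on \<open>t\<close> points. A \<open>w\<close>-subset \<open>S\<close> of \<open>F\<close> owns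
  a set \<open>T \<subseteq> \<Inter>S\<close> if no member of \<open>F\<close> outside \<open>S\<close> contains \<open>T\<close>; then \<open>T\<close> determines \<open>S\<close>,
  so at most as many \<open>S\<close> own a set of size at most \<open>m\<close> as there are such sets.
  If \<open>S\<close> owns no set of size at most \<open>m\<close>, then each \<open>m\<close> points of \<open>\<Inter>S\<close> can be covered by one
  further member, so even after deleting \<open>q = r div 2\<close> other members from \<open>\<Inter>S\<close> more than
  \<open>m (r - q)\<close> points remain. Inside a fixed \<open>(w + q)\<close>-subset \<open>K\<close> of \<open>F\<close> the remainders
  \<open>\<Inter>S - \<Union>(K - S)\<close> are pairwise disjoint. Averaging over \<open>K\<close>, if half of all \<open>S\<close> own no
  small set, then \<open>t\<close> is at least a constant times \<open>r ^ (w + 1) * m\<close>.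

  Choose the least \<open>m\<close> that contradicts this bound. Then there are at least
  \<open>(n choose w) / 2\<close> sets of at most \<open>m\<close> points. For \<open>m = 1\<close> this gives \<open>t\<close> of order \<open>n ^ w\<close>.
  For \<open>m \<ge> 2\<close> the number \<open>m\<close> is of order \<open>t / r ^ (w + 1)\<close>, and counting sets with the weight
  \<open>x = 1 / r ^ (w + 1)\<close> per point gives \<open>ln n\<close> at most of order \<open>m * ln r\<close>.
\<close>

section \<open>Counting small subsets and covering with few sets\<close>

text \<open>Since \<open>x \<le> 1\<close>, every counted set has weight \<open>x ^ card T\<close>
  at least \<open>x ^ m\<close>, while the weights of all subsets of \<open>U\<close> sum to
  \<open>(1 + x) ^ card U\<close>.\<close>

lemma card_small_subsets_le:
  fixes x :: real
  assumes U: "finite U" and x: "0 < x" "x \<le> 1"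
  shows "real (card {T. T \<subseteq> U \<and> card T \<le> m}) * x ^ m \<le> exp (x * real (card U))"
proof -
  let ?P = "{T. T \<subseteq> U \<and> card T \<le> m}"
  have "real (card ?P) * x ^ m = (\<Sum>T\<in>?P. x ^ m)" by simp
  also have "\<dots> \<le> (\<Sum>T\<in>?P. x ^ card T)"
    using x by (intro sum_mono power_decreasing) auto
  also have "\<dots> \<le> (\<Sum>T\<in>Pow U. x ^ card T)"
    using U x by (intro sum_mono2) auto
  also have "\<dots> = (1 + x) ^ card U"
    using prod_add[OF U, of "\<lambda>_. x" "\<lambda>_. 1"] by (simp add: add.commute)
  also have "\<dots> \<le> exp x ^ card U"
    using x exp_ge_add_one_self[of x] by (intro power_mono) auto
  also have "\<dots> = exp (x * real (card U))"
    by (simp add: exp_of_nat_mult[symmetric] mult.commute)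
  finally show ?thesis .
qed

text \<open>Greedy covering: each member of \<open>H\<close> removes a batch of \<open>m\<close>
  points, and the last batch may be smaller.\<close>

lemma cover_by_few:
  assumes "finite X" "\<And>T. T \<subseteq> X \<Longrightarrow> card T \<le> m \<Longrightarrow> \<exists>B\<in>H. T \<subseteq> B" "card X \<le> m * p"
  shows "\<exists>G\<subseteq>H. finite G \<and> card G \<le> p \<and> X \<subseteq> \<Union>G"
  using assms
proof (induction p arbitrary: X)
  case 0
  then show ?case by (intro exI[of _ "{}"]) auto
next
  case (Suc p)
  obtain T where T: "T \<subseteq> X" "card T = min m (card X)"
    by (metis obtain_subset_with_card_n min.cobounded2)
  obtain B where B: "B \<in> H" "T \<subseteq> B" using Suc.prems(2)[of T] T by auto
  have "card (X - T) = card X - card T"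
    using T Suc.prems(1) by (metis card_Diff_subset finite_subset)
  then have "card (X - T) \<le> m * p" using T Suc.prems(3) by auto
  with Suc.IH[of "X - T"] Suc.prems obtain G
    where G: "G \<subseteq> H" "finite G" "card G \<le> p" "X - T \<subseteq> \<Union>G" by blast
  then have "card (insert B G) \<le> Suc p" by (simp add: card_insert_if)
  with G B show ?case by (intro exI[of _ "insert B G"]) auto
qed

text \<open>Passes from indexed families to sets: an enumeration of \<open>G\<close> is padded to
  length \<open>r\<close>, which requires \<open>G\<close> to be nonempty.\<close>

lemma cover_free_sets:
  assumes cf: "cover_free w r F" and S: "S \<subseteq> F" "card S = w" "finite S"
    and G: "G \<subseteq> F - S" "G \<noteq> {}" "finite G" "card G \<le> r"
  shows "\<not> \<Inter>S \<subseteq> \<Union>G"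
proof -
  obtain A where "bij_betw A {1..w} S"
    using ex_bij_betw_nat_finite_1[OF S(3)] S(2) by auto
  then have A: "A ` {1..w} = S" by (simp add: bij_betw_def)
  obtain g where "bij_betw g {1..card G} G"
    using ex_bij_betw_nat_finite_1[OF G(3)] by auto
  then have g: "g ` {1..card G} = G" by (simp add: bij_betw_def)
  \<comment> \<open>Indices beyond \<open>card G\<close> repeat the last member of
    \<open>G\<close>.\<close>
  define B where "B j = g (min j (card G))" for j
  have "card G \<ge> 1" using G by (simp add: Suc_le_eq card_gt_0_iff)
  then have "(\<lambda>j. min j (card G)) ` {1..r} = {1..card G}"
    using G(4) by (auto simp: image_iff) (metis atLeastAtMost_iff le_trans min.absorb1 One_nat_def)
  then have B: "B ` {1..r} = G" unfolding B_def using g by (metis image_image)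
  have "\<not> (\<Inter>i\<in>{1..w}. A i) \<subseteq> (\<Union>j\<in>{1..r}. B j)"
    using cf[unfolded cover_free_def, rule_format, of A B] A B S G by blast
  then show ?thesis unfolding A B .
qed

section \<open>Subfamilies with and without small own sets\<close>

definition subsets_of_card :: "nat \<Rightarrow> 'a set \<Rightarrow> 'a set set" where
  "subsets_of_card w F = {S. S \<subseteq> F \<and> card S = w}"

definition owns :: "nat \<Rightarrow> 'a set set \<Rightarrow> 'a set set \<Rightarrow> bool" where
  "owns m F S \<longleftrightarrow> (\<exists>T\<subseteq>\<Inter>S. card T \<le> m \<and> (\<forall>B\<in>F - S. \<not> T \<subseteq> B))"

lemma card_owning_le:
  assumes U: "finite U" "F \<subseteq> Pow U" and w: "1 \<le> w"
  shows "card {S \<in> subsets_of_card w F. owns m F S} \<le> card {T. T \<subseteq> U \<and> card T \<le> m}"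
proof -
  let ?O = "{S \<in> subsets_of_card w F. owns m F S}"
  have "\<forall>S\<in>?O. \<exists>T. T \<subseteq> \<Inter>S \<and> card T \<le> m \<and> (\<forall>B\<in>F - S. \<not> T \<subseteq> B)"
    by (auto simp: owns_def)
  then obtain T where T: "\<And>S. S \<in> ?O \<Longrightarrow> T S \<subseteq> \<Inter>S \<and> card (T S) \<le> m \<and> (\<forall>B\<in>F - S. \<not> T S \<subseteq> B)"
    using bchoice by metis
  have "S = {B \<in> F. T S \<subseteq> B}" if "S \<in> ?O" for S
    using T[OF that] that by (auto simp: subsets_of_card_def)
  then have "inj_on T ?O" by (intro inj_on_inverseI[where g = "\<lambda>T. {B \<in> F. T \<subseteq> B}"]) simp
  moreover have "T ` ?O \<subseteq> {T. T \<subseteq> U \<and> card T \<le> m}"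
  proof (safe)
    fix S x assume S: "S \<in> subsets_of_card w F" "owns m F S" and x: "x \<in> T S"
    \<comment> \<open>Nonemptiness matters: \<open>\<Inter>{}\<close> would be the whole type and
      not a subset of \<open>U\<close>.\<close>
    from S w have "S \<noteq> {}" "S \<subseteq> F" by (auto simp: subsets_of_card_def)
    moreover have "T S \<subseteq> \<Inter>S" using T S by blast
    ultimately show "x \<in> U" using x U by blast
  qed (use T in auto)
  moreover have "finite {T. T \<subseteq> U \<and> card T \<le> m}" using U by simp
  ultimately show ?thesis by (metis (no_types, lifting) card_inj_on_le)
qed

text \<open>Otherwise \<open>r - q\<close> further members would cover what \<open>Q\<close> leaves
  of \<open>\<Inter>S\<close>, so at most \<open>r\<close> members outside \<open>S\<close> would
  cover \<open>\<Inter>S\<close>.\<close>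

lemma card_private_gt:
  assumes U: "finite U" "F \<subseteq> Pow U" and cf: "cover_free w r F" and w: "1 \<le> w"
    and S: "S \<in> subsets_of_card w F" "\<not> owns m F S"
    and Q: "Q \<subseteq> F - S" "card Q = q" "1 \<le> q" "q \<le> r"
  shows "m * (r - q) < card (\<Inter>S - \<Union>Q)"
proof (rule ccontr)
  let ?X = "\<Inter>S - \<Union>Q"
  assume "\<not> ?thesis"
  then have le: "card ?X \<le> m * (r - q)" by simp
  have F: "finite F" using U by (meson finite_Pow_iff finite_subset)
  have S': "S \<subseteq> F" "card S = w" using S by (auto simp: subsets_of_card_def)
  with w have "S \<noteq> {}" by auto
  with S' U have "\<Inter>S \<subseteq> U" by blast
  then have "finite ?X" using U by (meson finite_Diff finite_subset)
  moreover have "\<exists>B\<in>F - S. T \<subseteq> B" if "T \<subseteq> ?X" "card T \<le> m" for T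
  proof -
    have "T \<subseteq> \<Inter>S" using that(1) by (rule subset_trans) (rule Diff_subset)
    then show ?thesis using S(2) that(2) unfolding owns_def by meson
  qed
  ultimately obtain G where G: "G \<subseteq> F - S" "finite G" "card G \<le> r - q" "?X \<subseteq> \<Union>G"
    using cover_by_few[of ?X m "F - S" "r - q", OF _ _ le] by metis
  have "card (Q \<union> G) \<le> r" using card_Un_le[of Q G] G Q by simp
  moreover have "Q \<noteq> {}" "finite Q" using Q F by (auto intro: finite_subset)
  moreover have "Q \<union> G \<subseteq> F - S" using Q(1) G(1) by (rule Un_least)
  ultimately have "\<not> \<Inter>S \<subseteq> \<Union>(Q \<union> G)"
    using G(2) by (intro cover_free_sets[OF cf S' finite_subset[OF S'(1) F]]) auto
  moreover have "\<Inter>S \<subseteq> \<Union>(Q \<union> G)" using G(4) by (simp add: Diff_subset_conv)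
  ultimately show False by contradiction
qed

lemma card_supersets:
  assumes F: "finite F" and S: "S \<subseteq> F" "card S = w" and wk: "w \<le> k"
  shows "card {K. K \<subseteq> F \<and> card K = k \<and> S \<subseteq> K} = (card F - w) choose (k - w)"
proof -
  have fS: "finite S" using F S by (auto intro: finite_subset)
  have "bij_betw (\<lambda>L. L \<union> S) {L. L \<subseteq> F - S \<and> card L = k - w} {K. K \<subseteq> F \<and> card K = k \<and> S \<subseteq> K}"
  proof (rule bij_betw_byWitness[where f' = "\<lambda>K. K - S"])
    show "(\<lambda>L. L \<union> S) ` {L. L \<subseteq> F - S \<and> card L = k - w} \<subseteq> {K. K \<subseteq> F \<and> card K = k \<and> S \<subseteq> K}"
    proof (safe)
      fix L assume L: "L \<subseteq> F - S" "card L = k - w"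
      then have "finite L" using F by (auto intro: finite_subset)
      then have "card (L \<union> S) = card L + card S"
        using L fS by (intro card_Un_disjoint) auto
      then show "card (L \<union> S) = k" using L S wk by simp
    qed (use S in auto)
    show "(\<lambda>K. K - S) ` {K. K \<subseteq> F \<and> card K = k \<and> S \<subseteq> K} \<subseteq> {L. L \<subseteq> F - S \<and> card L = k - w}"
      using fS S by (auto simp: card_Diff_subset)
  qed auto
  then have "card {K. K \<subseteq> F \<and> card K = k \<and> S \<subseteq> K} = card {L. L \<subseteq> F - S \<and> card L = k - w}"
    by (simp add: bij_betw_same_card)
  also have "\<dots> = (card F - w) choose (k - w)"
    using F fS S by (simp add: n_subsets card_Diff_subset)
  finally show ?thesis .
qed

text \<open>Double counting of pairs \<open>S \<subseteq> K\<close> with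
  \<open>card K = w + q\<close>: each \<open>S\<close> lies in \<open>(card F - w) choose q\<close>
  sets \<open>K\<close>, and disjoint remainders limit the number of \<open>S\<close> inside one
  \<open>K\<close>.\<close>

lemma card_not_owning_le:
  assumes U: "finite U" "F \<subseteq> Pow U" and cf: "cover_free w r F" and w: "1 \<le> w"
    and q: "1 \<le> q" "q \<le> r"
  shows "m * (r - q) * card {S \<in> subsets_of_card w F. \<not> owns m F S} * ((card F - w) choose q)
           \<le> card U * (card F choose (w + q))"
proof -
  let ?N = "{S \<in> subsets_of_card w F. \<not> owns m F S}"
  let ?\<K> = "subsets_of_card (w + q) F"
  have F: "finite F" using U by (meson finite_Pow_iff finite_subset)
  then have fin: "finite (subsets_of_card v F)" for v unfolding subsets_of_card_def by simp
  have one: "card {S \<in> ?N. S \<subseteq> K} * (m * (r - q)) \<le> card U" if K: "K \<in> ?\<K>" for K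
  proof -
    let ?M = "{S \<in> ?N. S \<subseteq> K}"
    let ?X = "\<lambda>S. \<Inter>S - \<Union>(K - S)"
    have K': "K \<subseteq> F" "card K = w + q" "finite K"
      using K F by (auto simp: subsets_of_card_def intro: finite_subset)
    have sub: "?X S \<subseteq> U" if "S \<in> ?M" for S
    proof -
      have "S \<noteq> {}" "S \<subseteq> F" using that w by (auto simp: subsets_of_card_def)
      then show ?thesis using U by blast
    qed
    have "card ?M * (m * (r - q)) = (\<Sum>S\<in>?M. m * (r - q))" by simp
    also have "\<dots> \<le> (\<Sum>S\<in>?M. card (?X S))"
    proof (rule sum_mono)
      fix S assume S: "S \<in> ?M"
      then have "card (K - S) = q"
        using K' by (auto simp: subsets_of_card_def card_Diff_subset finite_subset)
      moreover have "K - S \<subseteq> F - S" using K' by blast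
      ultimately show "m * (r - q) \<le> card (?X S)"
        using card_private_gt[OF U cf w, of S m "K - S" q] S q by (simp add: less_imp_le)
    qed
    also have "\<dots> = card (\<Union>S\<in>?M. ?X S)"
    proof (rule card_UN_disjoint[symmetric])
      show "finite ?M" using fin by simp
      show "\<forall>S\<in>?M. finite (?X S)" using sub U by (meson finite_subset)
      \<comment> \<open>A point of \<open>?X S\<close> determines \<open>S\<close> as the set of
        members of \<open>K\<close> containing it.\<close>
      show "\<forall>S\<in>?M. \<forall>S'\<in>?M. S \<noteq> S' \<longrightarrow> ?X S \<inter> ?X S' = {}" by blast
    qed
    also have "\<dots> \<le> card U" using sub U by (intro card_mono) blast+
    finally show ?thesis .
  qed
  have "m * (r - q) * card ?N * ((card F - w) choose q)
      = (m * (r - q)) * (((card F - w) choose q) * card ?N)" by simp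
  also have "((card F - w) choose q) * card ?N = (\<Sum>K\<in>?\<K>. card {S \<in> ?N. S \<subseteq> K})"
  proof (rule sum_multicount[symmetric])
    show "finite ?\<K>" "finite ?N" using fin by auto
    show "\<forall>S\<in>?N. card {K \<in> ?\<K>. S \<subseteq> K} = (card F - w) choose q"
      using card_supersets[OF F, of _ w "w + q"] by (auto simp: subsets_of_card_def conj_assoc)
  qed
  also have "(m * (r - q)) * \<dots> = (\<Sum>K\<in>?\<K>. card {S \<in> ?N. S \<subseteq> K} * (m * (r - q)))"
    by (simp add: sum_distrib_left mult.commute)
  also have "\<dots> \<le> (\<Sum>K\<in>?\<K>. card U)" using one by (rule sum_mono)
  also have "\<dots> = card U * (card F choose (w + q))"
    using F by (simp add: subsets_of_card_def n_subsets)
  finally show ?thesis .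
qed

section \<open>The lower bound on the number of points\<close>

lemma half_owning:
  assumes U: "finite U" "F \<subseteq> Pow U" and cf: "cover_free w r F" and w: "1 \<le> w" and r: "2 \<le> r"
    and n: "w + r div 2 \<le> card F"
    and small: "real (card U) < real r ^ (w + 1) * real m / (4 * (2 * real w) ^ w)"
  shows "real (card F choose w) / 2 \<le> real (card {T. T \<subseteq> U \<and> card T \<le> m})"
proof (rule ccontr)
  assume neg: "\<not> ?thesis"
  let ?n = "card F" and ?q = "r div 2" and ?k = "w + r div 2"
  let ?O = "{S \<in> subsets_of_card w F. owns m F S}" and ?N = "{S \<in> subsets_of_card w F. \<not> owns m F S}"
  have F: "finite F" using U by (meson finite_Pow_iff finite_subset)
  then have fin: "finite (subsets_of_card w F)" unfolding subsets_of_card_def by simp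
  have "card ?O + card ?N = card (subsets_of_card w F)"
    using fin by (subst card_Un_disjoint[symmetric]) (auto intro: arg_cong[where f = card])
  also have "\<dots> = ?n choose w" unfolding subsets_of_card_def using F by (rule n_subsets)
  finally have "real (card ?O) + real (card ?N) = real (?n choose w)" by linarith
  moreover have "real (card ?O) \<le> real (card {T. T \<subseteq> U \<and> card T \<le> m})"
    using card_owning_le[OF U w, of m] by simp
  ultimately have half: "real (?n choose w) / 2 \<le> real (card ?N)" using neg by linarith
  have main: "m * (r - ?q) * card ?N * ((?n - w) choose ?q) \<le> card U * (?n choose ?k)"
    using card_not_owning_le[OF U cf w, of ?q m] r by simp
  \<comment> \<open>This identity lets all binomials in \<open>?n\<close> cancel, leaving a bound in
    \<open>m\<close>, \<open>r\<close> and \<open>w\<close> only.\<close>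
  have "(?n choose ?k) * (?k choose w) = (?n choose w) * ((?n - w) choose ?q)"
    using choose_mult[of w ?k ?n] n by simp
  then have cm: "real (?n choose ?k) * real (?k choose w) = real (?n choose w) * real ((?n - w) choose ?q)"
    by (metis of_nat_mult)
  have "(real m * real (r - ?q) * real (?k choose w) / 2) * real (?n choose ?k)
      = real m * real (r - ?q) * (real (?n choose w) / 2) * real ((?n - w) choose ?q)"
    using cm by (simp add: mult.commute mult.left_commute)
  also have "\<dots> \<le> real m * real (r - ?q) * real (card ?N) * real ((?n - w) choose ?q)"
    using half by (intro mult_right_mono mult_left_mono) auto
  also have "\<dots> \<le> real (card U) * real (?n choose ?k)"
    using of_nat_mono[OF main, where 'a = real] by (simp only: of_nat_mult)
  finally have ge: "real m * real (r - ?q) * real (?k choose w) / 2 \<le> real (card U)"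
    using n by (simp add: zero_less_binomial)
  \<comment> \<open>For odd \<open>r\<close>, the rounding loss in \<open>r div 2\<close> is made up
    by \<open>w \<ge> 1\<close>.\<close>
  have "real r / (2 * real w) \<le> real ?k / real w" using w r by (simp add: field_simps)
  then have "(real r / (2 * real w)) ^ w \<le> (real ?k / real w) ^ w"
    by (intro power_mono) auto
  also have "\<dots> \<le> real (?k choose w)"
    using binomial_ge_n_over_k_pow_k[of w ?k, where 'a = real] by simp
  finally have "real m * (real r / 2) * (real r / (2 * real w)) ^ w / 2
      \<le> real m * real (r - ?q) * real (?k choose w) / 2"
    by (intro divide_right_mono mult_mono mult_left_mono) auto
  also have "real m * (real r / 2) * (real r / (2 * real w)) ^ w / 2
      = real r ^ (w + 1) * real m / (4 * (2 * real w) ^ w)"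
    by (simp add: power_divide)
  finally show False using ge small by linarith
qed

lemma ground_set_lower_bound:
  fixes w r :: nat
  assumes U: "finite U" "F \<subseteq> Pow U" and cf: "cover_free w r F" and w: "1 \<le> w"
    and r: "2 \<le> r" "r < card F" and n: "4 * w ^ 2 \<le> card F"
  defines "c \<equiv> 1 / (4 * (2 * real w) ^ w)"
  shows "real (card F) ^ w / (6 * real w ^ w) \<le> real (card U) \<or>
    c / (4 * (w + 2)) * (real r ^ (w + 1) * ln (card F) / ln r) \<le> real (card U)"
proof -
  define t n a where "t = real (card U)" and "n = real (card F)" and "a = real r ^ (w + 1)"
  \<comment> \<open>The least natural number with \<open>t < c * a * m\<close>, the smallness
    hypothesis of \<open>half_owning\<close>.\<close>
  define m where "m = nat \<lfloor>t / (c * a)\<rfloor> + 1"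
  let ?T = "\<lambda>m. real (card {T. T \<subseteq> U \<and> card T \<le> m})"
  have c: "0 < c" using w by (simp add: c_def)
  have a: "1 \<le> a" unfolding a_def using r by (intro one_le_power) simp
  have t0: "0 \<le> t" by (simp add: t_def)
  have "w \<le> w ^ 2" using w by (simp add: power2_eq_square)
  then have kn: "w + r div 2 \<le> card F" and wn: "w \<le> card F" using n r by linarith+
  have "0 \<le> t / (c * a)" using c a t0 by simp
  then have "real m = of_int \<lfloor>t / (c * a)\<rfloor> + 1" by (simp add: m_def)
  then have m_ge: "real m - 1 \<le> t / (c * a)" and m_lt: "t / (c * a) < real m"
    using floor_correct[of "t / (c * a)"] by linarith+
  then have tm: "t < c * a * real m" using c a by (simp add: field_simps)
  then have half: "real (card F choose w) / 2 \<le> ?T m"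
    using half_owning[OF U cf w r(1) kn, of m] by (simp add: c_def t_def a_def field_simps)
  have binom: "(n / w) ^ w \<le> real (card F choose w)"
    using binomial_ge_n_over_k_pow_k[OF wn, where 'a = real] by (simp add: n_def)
  show ?thesis
  proof (cases "m = 1")
    case True
    have "card U \<noteq> 0"
    proof
      assume "card U = 0"
      then have "F \<subseteq> {{}}" using U by simp
      then have "card F \<le> 1" using card_mono[of "{{}}" F] by simp
      then show False using r by simp
    qed
    then have t1: "1 \<le> t" by (simp add: t_def)
    have "?T 1 * (1 / t) ^ 1 \<le> exp (1 / t * real (card U))"
      using t1 by (intro card_small_subsets_le U) auto
    then have "?T 1 \<le> exp 1 * t" using t1 by (simp add: t_def field_simps)
    also have "\<dots> \<le> 3 * t" using exp_le t1 by (intro mult_right_mono) auto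
    finally have "(n / w) ^ w \<le> 6 * t" using half binom True by simp
    then show ?thesis by (simp add: t_def n_def power_divide field_simps)
  next
    case False
    moreover have "1 \<le> m" by (simp add: m_def)
    ultimately have m2: "2 \<le> m" by linarith
    have lnr: "1 / 2 \<le> ln (real r)"
    proof -
      have "(1 / 2 :: real) \<le> ln 2" using ln_le_minus_one[of "1 / 2 :: real"] by (simp add: ln_div)
      also have "\<dots> \<le> ln (real r)" using r by simp
      finally show ?thesis .
    qed
    have c2: "c \<le> 1 / 2"
    proof -
      have "1 \<le> (2 * real w) ^ w" using w by (intro one_le_power) simp
      then show ?thesis unfolding c_def by (simp add: field_simps)
    qed
    have n4: "4 * real w ^ 2 \<le> n" using n unfolding n_def
      by (metis of_nat_le_iff of_nat_mult of_nat_numeral of_nat_power)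
    have n1: "1 < n" using r by (simp add: n_def)
    \<comment> \<open>The bound \<open>4 * w ^ 2 \<le> n\<close> absorbs the power of
      \<open>w\<close>; the factor 2 pays for the halving in \<open>half\<close>, and the root costs
      only a factor 2 in \<open>ln n\<close>.\<close>
    have "2 * sqrt n \<le> (n / w) ^ w"
    proof -
      have "2 * real w = sqrt (4 * real w ^ 2)" by (simp add: real_sqrt_mult)
      also have "\<dots> \<le> sqrt n" using n4 by simp
      finally have "2 * real w * sqrt n \<le> sqrt n * sqrt n"
        using n1 by (intro mult_right_mono) auto
      then have *: "2 * sqrt n \<le> n / w" using w n1 by (simp add: field_simps)
      moreover have "1 \<le> sqrt n" using n1 by simp
      ultimately have "1 \<le> n / w" by linarith
      then have "(n / w) ^ 1 \<le> (n / w) ^ w" using w by (intro power_increasing) auto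
      with * show ?thesis by simp
    qed
    then have "sqrt n \<le> ?T m" using binom half by linarith
    moreover have "?T m * (1 / a) ^ m \<le> exp (1 / a * t)"
      unfolding t_def using a by (intro card_small_subsets_le U) auto
    moreover have "exp (1 / a * t) \<le> exp (c * real m)"
      using tm a by (simp add: field_simps)
    ultimately have "sqrt n * (1 / a) ^ m \<le> exp (c * real m)"
      using a by (smt (verit) mult_right_mono zero_le_power zero_le_divide_1_iff)
    then have "sqrt n \<le> exp (c * real m) * a ^ m"
      using a by (simp add: field_simps power_divide)
    then have "ln (sqrt n) \<le> ln (exp (c * real m) * a ^ m)"
      using n1 a by (subst ln_le_cancel_iff) auto
    also have "\<dots> = real m * (c + (w + 1) * ln r)"
      using a r by (simp add: ln_mult ln_realpow a_def algebra_simps)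
    also have "\<dots> \<le> real m * ((w + 2) * ln r)"
      using c2 lnr by (intro mult_left_mono) (auto simp: algebra_simps)
    \<comment> \<open>Here \<open>m \<ge> 2\<close> enters: \<open>m \<le> 2 * (m - 1)\<close>, and
      \<open>m - 1\<close> is at most \<open>t / (c * a)\<close>.\<close>
    also have "\<dots> \<le> (2 * (t / (c * a))) * ((w + 2) * ln r)"
      using m_ge m2 lnr by (intro mult_right_mono) auto
    finally have "ln n / 2 \<le> (2 * (t / (c * a))) * ((w + 2) * ln r)"
      using n1 by (simp add: ln_sqrt)
    then have "ln n * (c * a) \<le> t * (ln r * (4 * (w + 2)))"
      using c a by (simp add: field_simps)
    moreover have "0 < ln r * (4 * (w + 2))" using lnr by simp
    ultimately have "ln n * (c * a) / (ln r * (4 * (w + 2))) \<le> t"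
      by (simp only: pos_divide_le_eq)
    moreover have "c / (4 * (w + 2)) * (a * ln n / ln r) = ln n * (c * a) / (ln r * (4 * (w + 2)))"
      by (simp add: mult_ac)
    ultimately have "c / (4 * (w + 2)) * (a * ln n / ln r) \<le> t" by simp
    then show ?thesis by (simp add: t_def n_def a_def)
  qed
qed

theorem theorem1p8:
  fixes w :: nat
  assumes "w \<ge> 1"
  shows "\<exists>c::real. c > 0 \<and>
           (\<forall>n r :: nat. 2 \<le> r \<and> r < n \<longrightarrow>
              real (cover_free_number n w r)
                \<ge> c * min (real n ^ w) (real r ^ (w + 1) * ln (real n) / ln (real r)))"
proof -
  \<comment> \<open>\<open>c1\<close> and \<open>c2\<close> come from the two alternatives of
    \<open>ground_set_lower_bound\<close>. \<open>c3\<close> serves \<open>n < 4 * w ^ 2\<close>,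
    where \<open>n ^ w\<close> is bounded in terms of \<open>w\<close> and at least one point
    suffices.\<close>
  define c1 where "c1 = 1 / (4 * (2 * real w) ^ w) / (4 * (w + 2))"
  define c2 where "c2 = 1 / (6 * real w ^ w)"
  define c3 where "c3 = 1 / (4 * real w ^ 2) ^ w"
  define c where "c = min c1 (min c2 c3)"
  have pos: "0 < c" using assms by (simp add: c_def c1_def c2_def c3_def)
  have "c * min (real n ^ w) (real r ^ (w + 1) * ln (real n) / ln (real r))
      \<le> real (cover_free_number n w r)" (is "c * min ?x ?y \<le> real ?t") if r: "2 \<le> r" "r < n" for n r
  proof -
    obtain F where F: "F \<subseteq> Pow {1..?t}" "card F = n" "cover_free w r F"
      using LeastI_ex[OF cover_free_family_exists[of n w r]] unfolding cover_free_number_def by blast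
    have x0: "0 \<le> ?x" and y0: "0 \<le> ?y" using r by auto
    have mx: "c * min ?x ?y \<le> d * ?x" if "c \<le> d" for d
      using that x0 y0 pos by (intro mult_mono) auto
    have my: "c * min ?x ?y \<le> c1 * ?y"
      using x0 y0 pos by (intro mult_mono) (auto simp: c_def)
    show ?thesis
    proof (cases "4 * w ^ 2 \<le> n")
      case True
      then have "?x / (6 * real w ^ w) \<le> real ?t \<or> c1 * ?y \<le> real ?t"
        using ground_set_lower_bound[OF _ F(1,3) assms r(1)] r F(2) by (simp add: c1_def)
      moreover have "c * min ?x ?y \<le> ?x / (6 * real w ^ w)"
        using mx[of c2] by (simp add: c_def c2_def)
      ultimately show ?thesis using my by linarith
    next
      case False
      then have "real n \<le> 4 * real w ^ 2"
        by (metis nat_le_linear of_nat_le_iff of_nat_mult of_nat_numeral of_nat_power)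
      then have "?x \<le> (4 * real w ^ 2) ^ w" by (intro power_mono) auto
      then have "c3 * ?x \<le> 1" using assms by (simp add: c3_def field_simps)
      moreover have "?t \<noteq> 0"
      proof
        assume "?t = 0"
        then have "F \<subseteq> {{}}" using F by simp
        then have "card F \<le> 1" using card_mono[of "{{}}" F] by simp
        then show False using r F by simp
      qed
      then have "1 \<le> real ?t" by simp
      moreover have "c * min ?x ?y \<le> c3 * ?x" by (rule mx) (simp add: c_def)
      ultimately show ?thesis by linarith
    qed
  qed
  with pos show ?thesis by blast
qed

end
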